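(* Let $E_n$ ($n\ge 1$) be the Bethe cacti defined below. Then $M(E_1;x,y)=2xy^2$, $M(E_2;x,y)=6x^2y^2+4x^2y^3+2x^2y^4+2x^3y^4$, and for every $n\ge 3$, $$M(E_n;x,y)=2\cdot 3^{n-1}x^2y^2+2\cdot 3^{n-1}x^2y^4+6x^3y^4+(2\cdot 3^{n-1}-10)x^4y^4 .$$
   Context: For a finite simple graph $G$ and integers $i,j\ge 1$, let $m_{i,j}(G)$ be the number of edges $uv$ of $G$ with $\{d_u(G),d_v(G)\}=\{i,j\}$, where $d_v(G)$ is the degree of $v$. The $M$-polynomial of $G$ is $M(G;x,y)=\sum_{i\le j} m_{i,j}(G)\,x^iy^j$. Rooted Bethe cacti $D_n$: $D_1$ is a $4$-cycle with one designated vertex, its root. For $n\ge 2$, take a $4$-cycle with vertices $a,b,c,d$ in cyclic order, declare $a$ the root of $D_n$, and take three disjoint copies of $D_{n-1}$, identifying their roots with $b$, $c$, $d$ respectively. Bethe cacti $E_n$: $E_1$ is the path on three vertices. For $n\ge 2$, $E_n$ is obtained from a path on three vertices by taking three disjoint copies of $D_{n-1}$ and identifying the root of each copy with a different vertex of the path. *)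

theory Defs
  imports "HOL-Computational_Algebra.Polynomial"
begin

record 'v ugraph =
  verts :: "'v set"
  edges :: "'v set set"

definition finite_simple_graph :: "'v ugraph \<Rightarrow> bool" where
  "finite_simple_graph G \<longleftrightarrow>
     finite (verts G) \<and> (\<forall>e\<in>edges G. e \<subseteq> verts G \<and> card e = 2)"

definition degree_of :: "'v ugraph \<Rightarrow> 'v \<Rightarrow> nat" where
  "degree_of G v = card {e \<in> edges G. v \<in> e}"

definition edge_count :: "'v ugraph \<Rightarrow> nat \<Rightarrow> nat \<Rightarrow> nat" where
  "edge_count G i j =
     card {e \<in> edges G. \<exists>u v. e = {u, v} \<and> {degree_of G u, degree_of G v} = {i, j}}"

text \<open>Bivariate integer polynomials are elements of \<open>(\<int>[x])[y]\<close>: the inner polynomial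
  variable is \<open>x\<close>, the outer one is \<open>y\<close>.\<close>

definition xvar :: "int poly poly" where
  "xvar = [:[:0, 1:]:]"

definition yvar :: "int poly poly" where
  "yvar = [:0, 1:]"

text \<open>The index set is restricted to the nonzero coefficients because \<open>sum\<close> over an infinite
  set is 0; for a finite graph this set is finite and only zero terms are left out.\<close>

definition M_polynomial :: "'v ugraph \<Rightarrow> int poly poly" where
  "M_polynomial G =
     (\<Sum>(i, j) \<in> {(i, j). 1 \<le> i \<and> i \<le> j \<and> edge_count G i j \<noteq> 0}.
        of_nat (edge_count G i j) * xvar ^ i * yvar ^ j)"

definition path3 :: "'v \<Rightarrow> 'v \<Rightarrow> 'v \<Rightarrow> 'v ugraph" where
  "path3 a b c = \<lparr>verts = {a, b, c}, edges = {{a, b}, {b, c}}\<rparr>"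

definition cycle4 :: "'v \<Rightarrow> 'v \<Rightarrow> 'v \<Rightarrow> 'v \<Rightarrow> 'v ugraph" where
  "cycle4 a b c d =
     \<lparr>verts = {a, b, c, d}, edges = {{a, b}, {b, c}, {c, d}, {d, a}}\<rparr>"

definition graph_union :: "'v ugraph \<Rightarrow> 'v ugraph \<Rightarrow> 'v ugraph" where
  "graph_union G H = \<lparr>verts = verts G \<union> verts H, edges = edges G \<union> edges H\<rparr>"

text \<open>Vertices are lists of labels. The \<open>k\<close>-th copy of a graph has the vertices \<open>k # v\<close>, so
  copies with different labels are disjoint.\<close>

definition copy :: "nat \<Rightarrow> nat list ugraph \<Rightarrow> nat list ugraph" where
  "copy k G = \<lparr>verts = (#) k ` verts G, edges = (\<lambda>e. (#) k ` e) ` edges G\<rparr>"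

definition three_copies :: "nat list ugraph \<Rightarrow> nat list ugraph" where
  "three_copies G = graph_union (copy 1 G) (graph_union (copy 2 G) (copy 3 G))"

text \<open>The root of every rooted Bethe cactus is the empty list. The root of its \<open>k\<close>-th copy is
  therefore \<open>[k]\<close>, and uniting the copies with a cycle or path through \<open>[1]\<close>, \<open>[2]\<close>, \<open>[3]\<close>
  identifies the roots of the copies with these three vertices and nothing else.
  Both families are indexed from 1; the value at 0 is left unspecified.\<close>

fun rooted_bethe_cactus :: "nat \<Rightarrow> nat list ugraph" where
  "rooted_bethe_cactus (Suc 0) = cycle4 [] [1] [2] [3]"
| "rooted_bethe_cactus (Suc (Suc n)) =
     graph_union (cycle4 [] [1] [2] [3]) (three_copies (rooted_bethe_cactus (Suc n)))"

fun bethe_cactus :: "nat \<Rightarrow> nat list ugraph" where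
  "bethe_cactus (Suc 0) = path3 [1] [2] [3]"
| "bethe_cactus (Suc (Suc n)) =
     graph_union (path3 [1] [2] [3]) (three_copies (rooted_bethe_cactus (Suc n)))"

lemma finite_simple_graph_union:
  "finite_simple_graph G \<Longrightarrow> finite_simple_graph H \<Longrightarrow> finite_simple_graph (graph_union G H)"
  by (auto simp: finite_simple_graph_def graph_union_def)

lemma finite_simple_graph_three_copies:
  "finite_simple_graph G \<Longrightarrow> finite_simple_graph (three_copies G)"
  unfolding three_copies_def
  by (intro finite_simple_graph_union)
     (auto simp: finite_simple_graph_def copy_def card_image)

lemma root_in_rooted_bethe_cactus:
  "n \<ge> 1 \<Longrightarrow> [] \<in> verts (rooted_bethe_cactus n)"
  by (cases n rule: rooted_bethe_cactus.cases) (auto simp: graph_union_def cycle4_def)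

lemma finite_simple_graph_cycle4:
  "distinct [a, b, c, d] \<Longrightarrow> finite_simple_graph (cycle4 a b c d)"
  by (auto simp: finite_simple_graph_def cycle4_def)

lemma finite_simple_graph_path3:
  "distinct [a, b, c] \<Longrightarrow> finite_simple_graph (path3 a b c)"
  by (auto simp: finite_simple_graph_def path3_def)

lemma finite_simple_graph_rooted_bethe_cactus:
  "n \<ge> 1 \<Longrightarrow> finite_simple_graph (rooted_bethe_cactus n)"
  by (induction n rule: rooted_bethe_cactus.induct)
     (simp_all add: finite_simple_graph_cycle4 finite_simple_graph_union
        finite_simple_graph_three_copies)

lemma finite_simple_graph_bethe_cactus:
  "n \<ge> 1 \<Longrightarrow> finite_simple_graph (bethe_cactus n)"
  by (cases n rule: bethe_cactus.cases)
     (simp_all add: finite_simple_graph_path3 finite_simple_graph_union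
        finite_simple_graph_three_copies finite_simple_graph_rooted_bethe_cactus)

end

theory Submission imports Defs begin

text \<open>The M-polynomial is the sum over all edges of the monomial read off from the two end degrees.
  Gluing three copies of a rooted graph onto a base changes no degree inside the copies except at
  the roots, so this sum is determined recursively once the degree of the root is made a free
  parameter.\<close>

section \<open>The M-polynomial as a sum over edges\<close>

definition edge_monomial :: "('v \<Rightarrow> nat) \<Rightarrow> 'v set \<Rightarrow> int poly poly" where
  "edge_monomial d e = xvar ^ Min (d ` e) * yvar ^ Max (d ` e)"

lemma edge_monomial_doubleton:
  "edge_monomial d {u, v} = xvar ^ min (d u) (d v) * yvar ^ max (d u) (d v)"
  by (simp add: edge_monomial_def)

lemma edge_monomial_image: "edge_monomial d (f ` e) = edge_monomial (d \<circ> f) e"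
  by (simp add: edge_monomial_def image_comp)

lemma finite_simple_graph_edgesD:
  assumes "finite_simple_graph G"
  shows "finite (edges G)" and "e \<in> edges G \<Longrightarrow> finite e \<and> card e = 2"
proof -
  have "edges G \<subseteq> Pow (verts G)" "finite (verts G)"
    using assms by (auto simp: finite_simple_graph_def)
  then show "finite (edges G)"
    by (meson finite_Pow_iff finite_subset)
  show "e \<in> edges G \<Longrightarrow> finite e \<and> card e = 2"
    using assms by (metis card.infinite finite_simple_graph_def zero_neq_numeral)
qed

text \<open>Writing degrees as edge sums lets one decomposition of the edge set yield both degrees
  and sums of monomials.\<close>

lemma degree_of_eq_sum:
  assumes "finite_simple_graph G"
  shows "degree_of G v = (\<Sum>e\<in>edges G. of_bool (v \<in> e))"
proof -
  have "{e \<in> edges G. v \<in> e} = edges G \<inter> {e. v \<in> e}" by blast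
  then show ?thesis
    using finite_simple_graph_edgesD(1)[OF assms] by (simp add: degree_of_def)
qed

text \<open>Group the edges by their sorted pair of end degrees: each fibre has constant monomial,
  and its size is the corresponding coefficient.\<close>

lemma M_polynomial_eq_sum:
  assumes G: "finite_simple_graph G"
  shows "M_polynomial G = (\<Sum>e\<in>edges G. edge_monomial (degree_of G) e)"
proof -
  let ?d = "degree_of G"
  define key where "key e = (Min (?d ` e), Max (?d ` e))" for e
  have fin: "finite (edges G)" using finite_simple_graph_edgesD(1)[OF G] .
  have deg_pos: "1 \<le> ?d v" if "e \<in> edges G" "v \<in> e" for e v
    using that fin by (auto simp: degree_of_def Suc_le_eq card_gt_0_iff)
  have key_le: "1 \<le> i \<and> i \<le> j" if "e \<in> edges G" "key e = (i, j)" for e i j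
  proof -
    obtain u v where "e = {u, v}"
      using finite_simple_graph_edgesD(2)[OF G \<open>e \<in> edges G\<close>] by (metis card_2_iff)
    then show ?thesis
      using that deg_pos[of e u] deg_pos[of e v] by (auto simp: key_def)
  qed
  \<comment> \<open>Since \<open>key\<close> is sorted, it misses pairs with i > j, whereas
    \<open>edge_count\<close> is symmetric; hence the condition.\<close>
  have count: "edge_count G i j = card {e \<in> edges G. key e = (i, j)}" if "i \<le> j" for i j
  proof -
    have "(\<exists>u v. e = {u, v} \<and> {?d u, ?d v} = {i, j}) \<longleftrightarrow> key e = (i, j)" if "e \<in> edges G" for e
    proof -
      obtain u v where e: "e = {u, v}"
        using finite_simple_graph_edgesD(2)[OF G \<open>e \<in> edges G\<close>] by (metis card_2_iff)
      have "key e = (i, j) \<longleftrightarrow> {?d u, ?d v} = {i, j}"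
        using \<open>i \<le> j\<close> by (auto simp: key_def e doubleton_eq_iff min_def max_def)
      then show ?thesis
        using e by (auto simp: doubleton_eq_iff)
    qed
    then show ?thesis
      unfolding edge_count_def by (metis (mono_tags, lifting))
  qed
  have index: "{(i, j). 1 \<le> i \<and> i \<le> j \<and> edge_count G i j \<noteq> 0} = key ` edges G" (is "?I = _")
  proof (intro set_eqI iffI)
    fix p assume "p \<in> ?I"
    then show "p \<in> key ` edges G"
      by (cases p) (force simp: count card_gt_0_iff)
  next
    fix p assume "p \<in> key ` edges G"
    then obtain e i j where e: "e \<in> edges G" "key e = (i, j)" and p: "p = (i, j)"
      by (metis imageE surj_pair)
    moreover have "card {e \<in> edges G. key e = (i, j)} \<noteq> 0"
      using e fin by auto
    ultimately show "p \<in> ?I"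
      using key_le[OF e] by (simp add: count)
  qed
  have "(\<Sum>e\<in>edges G. edge_monomial ?d e)
      = (\<Sum>p\<in>key ` edges G. \<Sum>e\<in>{e \<in> edges G. key e = p}. edge_monomial ?d e)"
    by (rule sum.image_gen[OF fin])
  also have "\<dots> = (\<Sum>(i, j)\<in>key ` edges G. of_nat (edge_count G i j) * xvar ^ i * yvar ^ j)"
  proof (rule sum.cong[OF refl])
    fix p assume "p \<in> key ` edges G"
    obtain i j where p: "p = (i, j)" by (cases p)
    then have "i \<le> j" using key_le \<open>p \<in> key ` edges G\<close> by fastforce
    have "(\<Sum>e\<in>{e \<in> edges G. key e = p}. edge_monomial ?d e)
        = (\<Sum>e\<in>{e \<in> edges G. key e = p}. xvar ^ i * yvar ^ j)"
      by (rule sum.cong) (auto simp: key_def edge_monomial_def p)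
    then show "(\<Sum>e\<in>{e \<in> edges G. key e = p}. edge_monomial ?d e)
        = (case p of (i, j) \<Rightarrow> of_nat (edge_count G i j) * xvar ^ i * yvar ^ j)"
      using count[OF \<open>i \<le> j\<close>] by (simp add: p mult.assoc)
  qed
  finally show ?thesis
    by (simp only: M_polynomial_def index)
qed

section \<open>Gluing three copies onto a base that meets each copy in at most its root\<close>

locale glued_copies =
  fixes B G :: "nat list ugraph"
  assumes simple_base: "finite_simple_graph B"
    and simple_copy: "finite_simple_graph G"
    and verts_base: "verts B \<subseteq> {[], [1], [2], [3]}"
begin

abbreviation glued :: "nat list ugraph" where
  "glued \<equiv> graph_union B (three_copies G)"

lemma simple_glued: "finite_simple_graph glued"
  using simple_base simple_copy
  by (simp add: finite_simple_graph_union finite_simple_graph_three_copies)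

text \<open>An edge of a copy has two ends and only the root of the copy can lie in the base, so no
  copied edge is a base edge; different copies are separated by their labels. It is applied over
  \<open>nat\<close> for degrees and over polynomials for monomials.\<close>

lemma sum_edges_glued:
  fixes f :: "nat list set \<Rightarrow> 'a :: comm_monoid_add"
  shows "(\<Sum>e\<in>edges glued. f e)
       = (\<Sum>e\<in>edges B. f e) + (\<Sum>k\<in>{1, 2, 3}. \<Sum>e\<in>edges G. f ((#) k ` e))"
proof -
  let ?C = "\<lambda>k. (\<lambda>e. (#) k ` e) ` edges G"
  have eq: "edges glued = edges B \<union> (\<Union>k\<in>{1, 2, 3}. ?C k)"
    by (auto simp: graph_union_def three_copies_def copy_def)
  have fin: "finite (edges B)" "finite (edges G)"
    using simple_base simple_copy by (auto intro: finite_simple_graph_edgesD(1))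
  have "(#) k ` e \<notin> edges B" if "e \<in> edges G" for k e
  proof
    assume "(#) k ` e \<in> edges B"
    then have "(#) k ` e \<subseteq> {[], [1], [2], [3]}"
      using simple_base verts_base unfolding finite_simple_graph_def by (meson subset_trans)
    \<comment> \<open>Every \<open>k # v\<close> is nonempty, and the remaining members of the set
      have length one, which forces v to be the root.\<close>
    then have "e \<subseteq> {[]}" by auto
    then have "card e \<le> 1" by (metis card_mono card.empty card_insert_disjoint
          empty_iff finite.emptyI finite_insert One_nat_def)
    then show False
      using finite_simple_graph_edgesD(2)[OF simple_copy that] by simp
  qed
  then have disj: "edges B \<inter> (\<Union>k\<in>{1, 2, 3}. ?C k) = {}" by blast
  have disj_copies: "?C k \<inter> ?C l = {}" if "k \<noteq> l" for k l
  proof -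
    have "(#) k ` e \<noteq> (#) l ` e'" if "e \<in> edges G" for e e'
    proof
      assume eq: "(#) k ` e = (#) l ` e'"
      obtain v where "v \<in> e"
        using finite_simple_graph_edgesD(2)[OF simple_copy \<open>e \<in> edges G\<close>] by fastforce
      with eq have "k # v \<in> (#) l ` e'" by blast
      with \<open>k \<noteq> l\<close> show False by auto
    qed
    then show ?thesis by blast
  qed
  have "sum f (?C k) = (\<Sum>e\<in>edges G. f ((#) k ` e))" for k
    by (subst sum.reindex) (auto simp: inj_on_def inj_image_eq_iff)
  moreover have "sum f (\<Union>k\<in>{1, 2, 3}. ?C k) = (\<Sum>k\<in>{1, 2, 3}. sum f (?C k))"
    using fin disj_copies by (intro sum.UNION_disjoint) simp_all
  moreover have "sum f (edges glued) = sum f (edges B) + sum f (\<Union>k\<in>{1, 2, 3}. ?C k)"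
    unfolding eq using fin by (intro sum.union_disjoint disj) simp_all
  ultimately show ?thesis
    by simp
qed

lemma degree_of_glued_Nil: "degree_of glued [] = degree_of B []"
  using sum_edges_glued[of "\<lambda>e. of_bool ([] \<in> e) :: nat"]
  by (simp add: degree_of_eq_sum simple_glued simple_base image_iff)

lemma degree_of_glued_Cons:
  assumes "k \<in> {1, 2, 3}"
  shows "degree_of glued (k # v) = degree_of B (k # v) + degree_of G v"
proof -
  have "k # v \<in> (#) l ` e \<longleftrightarrow> l = k \<and> v \<in> e" for l e by auto
  then have "(\<Sum>e\<in>edges G. of_bool (k # v \<in> (#) l ` e) :: nat)
      = (if l = k then degree_of G v else 0)"
    for l by (simp add: degree_of_eq_sum simple_copy)
  moreover have "(\<Sum>l\<in>{1, 2, 3}. if l = k then degree_of G v else 0) = degree_of G v"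
    using assms by (subst sum.delta) simp_all
  ultimately show ?thesis
    using sum_edges_glued[of "\<lambda>e. of_bool (k # v \<in> e) :: nat"]
    by (simp only: degree_of_eq_sum[OF simple_glued] degree_of_eq_sum[OF simple_base])
qed

lemma degree_of_base_eq_0:
  assumes "v \<noteq> []"
  shows "degree_of B (k # v) = 0"
proof -
  have "k # v \<notin> verts B" using verts_base assms by auto
  then have "{e \<in> edges B. k # v \<in> e} = {}"
    using simple_base unfolding finite_simple_graph_def by blast
  then show ?thesis by (simp only: degree_of_def card.empty)
qed

text \<open>Overriding the degree at the root is invisible inside the copies, whose vertices are
  nonempty lists. Each copy sees its own degrees, changed only at its root, so the sums over the
  copies have the same shape as the original one and a recursion closes.\<close>

lemma sum_edge_monomial_glued:
  "(\<Sum>e\<in>edges glued. edge_monomial ((degree_of glued)([] := r)) e)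
    = (\<Sum>e\<in>edges B. edge_monomial ((degree_of glued)([] := r)) e)
      + (\<Sum>k\<in>{1, 2, 3}. \<Sum>e\<in>edges G.
           edge_monomial ((degree_of G)([] := degree_of B [k] + degree_of G [])) e)"
proof -
  have "(degree_of glued)([] := r) \<circ> (#) k
      = (degree_of G)([] := degree_of B [k] + degree_of G [])" if "k \<in> {1, 2, 3}" for k
    using that by (auto simp: fun_eq_iff degree_of_glued_Cons degree_of_base_eq_0)
  then show ?thesis
    by (simp only: sum_edges_glued edge_monomial_image cong: sum.cong)
qed

end

section \<open>The base graphs: the 4-cycle and the path\<close>

lemma degree_of_cycle4:
  assumes "distinct [a, b, c, d]" "v \<in> {a, b, c, d}"
  shows "degree_of (cycle4 a b c d) v = 2"
proof -
  have "finite_simple_graph (cycle4 a b c d)"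
    using assms(1) by (rule finite_simple_graph_cycle4)
  then show ?thesis
    using assms by (auto simp: degree_of_eq_sum cycle4_def doubleton_eq_iff)
qed

lemma degree_of_path3:
  assumes "distinct [a, b, c]"
  shows "degree_of (path3 a b c) a = 1" "degree_of (path3 a b c) b = 2"
    "degree_of (path3 a b c) c = 1"
proof -
  have "finite_simple_graph (path3 a b c)"
    using assms by (rule finite_simple_graph_path3)
  then show "degree_of (path3 a b c) a = 1" "degree_of (path3 a b c) b = 2"
    "degree_of (path3 a b c) c = 1"
    using assms by (auto simp: degree_of_eq_sum path3_def doubleton_eq_iff)
qed

lemma sum_edges_cycle4:
  assumes "distinct [a, b, c, d]"
  shows "(\<Sum>e\<in>edges (cycle4 a b c d). f e) = f {a, b} + (f {b, c} + (f {c, d} + f {d, a}))"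
  using assms by (auto simp: cycle4_def doubleton_eq_iff)

lemma sum_edges_path3:
  assumes "distinct [a, b, c]"
  shows "(\<Sum>e\<in>edges (path3 a b c). f e) = f {a, b} + f {b, c}"
  using assms by (simp add: path3_def doubleton_eq_iff)

lemma glued_copies_cycle4:
  "glued_copies (cycle4 [] [1] [2] [3]) (rooted_bethe_cactus (Suc n))"
  by unfold_locales
    (simp_all add: finite_simple_graph_cycle4 finite_simple_graph_rooted_bethe_cactus,
      simp add: cycle4_def)

lemma glued_copies_path3:
  "glued_copies (path3 [1] [2] [3]) (rooted_bethe_cactus (Suc n))"
  by unfold_locales
    (simp_all add: finite_simple_graph_path3 finite_simple_graph_rooted_bethe_cactus,
      simp add: path3_def)

section \<open>The rooted cacti with prescribed root degree\<close>

lemma degree_of_rooted_bethe_cactus_root: "degree_of (rooted_bethe_cactus (Suc n)) [] = 2"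
  by (cases n) (simp_all add: degree_of_cycle4
      glued_copies.degree_of_glued_Nil[OF glued_copies_cycle4[unfolded One_nat_def]])

text \<open>The contribution of a copy of D_n inside a larger graph in which its root has total
  degree r.\<close>

definition rooted_M :: "nat \<Rightarrow> nat \<Rightarrow> int poly poly" where
  "rooted_M n r = (\<Sum>e\<in>edges (rooted_bethe_cactus n).
     edge_monomial ((degree_of (rooted_bethe_cactus n))([] := r)) e)"

lemma rooted_M_1:
  "rooted_M (Suc 0) r = 2 * xvar ^ 2 * yvar ^ 2 + 2 * xvar ^ min r 2 * yvar ^ max r 2"
  by (simp add: rooted_M_def sum_edges_cycle4 edge_monomial_doubleton degree_of_cycle4
      min.commute max.commute)

text \<open>The three glued roots have degree 2 + 2 = 4. Two cycle edges meet the outer root, the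
  other two join vertices of degree 4, and each copy is seen with root degree 4.\<close>

lemma rooted_M_step:
  "rooted_M (Suc (Suc n)) r = 2 * xvar ^ min r 4 * yvar ^ max r 4 + 2 * xvar ^ 4 * yvar ^ 4
    + 3 * rooted_M (Suc n) 4"
proof -
  interpret glued_copies "cycle4 [] [1] [2] [3]" "rooted_bethe_cactus (Suc n)"
    by (rule glued_copies_cycle4)
  show ?thesis
    using sum_edge_monomial_glued[of r] degree_of_glued_Cons[of _ "[]"]
    by (simp add: rooted_M_def sum_edges_cycle4 edge_monomial_doubleton degree_of_cycle4
        degree_of_rooted_bethe_cactus_root min.commute max.commute)
qed

text \<open>Only the two cycle edges at the root depend on r. For r = 4 they join the x^4 y^4 term,
  so its separate coefficient c obeys c -> 3 (c + 2) + 2, whose fixed point is -4.\<close>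

lemma rooted_M_Suc_Suc:
  "rooted_M (Suc (Suc n)) r = 2 * xvar ^ min r 4 * yvar ^ max r 4
    + 2 * 3 ^ Suc n * xvar ^ 2 * yvar ^ 2 + 2 * 3 ^ Suc n * xvar ^ 2 * yvar ^ 4
    + (2 * 3 ^ Suc n - 4) * xvar ^ 4 * yvar ^ 4"
proof (induction n arbitrary: r)
  case 0
  show ?case by (simp add: rooted_M_step rooted_M_1 algebra_simps)
next
  case (Suc n)
  show ?case by (subst rooted_M_step, subst Suc) (simp add: algebra_simps)
qed

section \<open>The cacti E_n\<close>

lemma M_polynomial_bethe_cactus_Suc_Suc:
  "M_polynomial (bethe_cactus (Suc (Suc n))) = 2 * xvar ^ 3 * yvar ^ 4
    + 2 * rooted_M (Suc n) 3 + rooted_M (Suc n) 4"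
proof -
  interpret glued_copies "path3 [1] [2] [3]" "rooted_bethe_cactus (Suc n)"
    by (rule glued_copies_path3)
  show ?thesis
    \<comment> \<open>Taking r to be the actual degree of \<open>[]\<close> makes the override
      trivial. The path ends get degree 1 + 2 = 3 and its middle 2 + 2 = 4, so two copies are seen
      with root degree 3 and one with 4.\<close>
    using M_polynomial_eq_sum[OF simple_glued] sum_edge_monomial_glued[of "degree_of glued []"]
      degree_of_glued_Cons[of _ "[]"]
    by (simp add: rooted_M_def sum_edges_path3 edge_monomial_doubleton degree_of_path3
        degree_of_rooted_bethe_cactus_root del: One_nat_def add_2_eq_Suc add_2_eq_Suc')
qed

theorem theorem3p3:
  shows "M_polynomial (bethe_cactus 1) = 2 * xvar * yvar ^ 2 \<and>
    M_polynomial (bethe_cactus 2) =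
      6 * xvar ^ 2 * yvar ^ 2 + 4 * xvar ^ 2 * yvar ^ 3
      + 2 * xvar ^ 2 * yvar ^ 4 + 2 * xvar ^ 3 * yvar ^ 4 \<and>
    (\<forall>n\<ge>3. M_polynomial (bethe_cactus n) =
      2 * 3 ^ (n - 1) * xvar ^ 2 * yvar ^ 2
      + 2 * 3 ^ (n - 1) * xvar ^ 2 * yvar ^ 4
      + 6 * xvar ^ 3 * yvar ^ 4
      + (2 * 3 ^ (n - 1) - 10) * xvar ^ 4 * yvar ^ 4)"
proof (intro conjI allI impI)
  show "M_polynomial (bethe_cactus 1) = 2 * xvar * yvar ^ 2"
    by (simp add: M_polynomial_eq_sum finite_simple_graph_path3 sum_edges_path3
        edge_monomial_doubleton degree_of_path3 power2_eq_square)
  show "M_polynomial (bethe_cactus 2) =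
      6 * xvar ^ 2 * yvar ^ 2 + 4 * xvar ^ 2 * yvar ^ 3
      + 2 * xvar ^ 2 * yvar ^ 4 + 2 * xvar ^ 3 * yvar ^ 4"
    \<comment> \<open>The copies here are D_1, which lies below the range of the closed form
      \<open>rooted_M_Suc_Suc\<close>; hence the separate case.\<close>
    using M_polynomial_bethe_cactus_Suc_Suc[of 0]
    by (simp add: rooted_M_1 eval_nat_numeral algebra_simps)
next
  fix n :: nat
  assume "n \<ge> 3"
  then obtain m where "n = 3 + m"
    using le_Suc_ex by blast
  then have n: "n = Suc (Suc (Suc m))"
    by simp
  show "M_polynomial (bethe_cactus n) =
      2 * 3 ^ (n - 1) * xvar ^ 2 * yvar ^ 2
      + 2 * 3 ^ (n - 1) * xvar ^ 2 * yvar ^ 4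
      + 6 * xvar ^ 3 * yvar ^ 4
      + (2 * 3 ^ (n - 1) - 10) * xvar ^ 4 * yvar ^ 4"
    \<comment> \<open>The 6 is 2 from the path plus 2 from each of the two copies with root degree
      3; the -10 is 3 (-4) + 2, the 2 coming from the middle copy.\<close>
    unfolding n M_polynomial_bethe_cactus_Suc_Suc rooted_M_Suc_Suc diff_Suc_1
    by (simp add: algebra_simps)
qed

end
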